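(* Consider a 2-dimensional DNN with the ReLU function, with system state $\mathbf{x}(t)=(x_1(t),x_2(t))$ and initial state $\mathbf{x}(0)\in[-1,1]^2$. Let the angle of the system state be $\theta(t)=\arctan\left(\frac{x_2(t)}{x_1(t)}\right)$. Then for any number $C>0$ one can find a set of parameters of the DNN (matrices $\mathbf{W}_t\in\mathbb{R}^{2\times 2}$ and vectors $\mathbf{b}_t\in\mathbb{R}^2$, $t=1,2,\dots$) and a time $T$ such that $$\left\|\nabla_{\mathbf{x}(0)}\theta(T)\right\|>C ,$$ where $\nabla_{\mathbf{x}(0)}$ is the gradient of $\theta(T)$, regarded as a function of the initial state, evaluated at $\mathbf{x}(0)$.
   Context: The DNN dynamics with parameters $(\mathbf{W}_t,\mathbf{b}_t)_{t\ge1}$ is $\mathbf{x}(t)=\phi(\mathbf{W}_t\mathbf{x}(t-1)+\mathbf{b}_t)$, $t=1,2,\dots$, where $\phi$ is the ReLU function $\phi(h)=\max\{h,0\}$ applied elementwise. The derivative of $\phi$ is $0$ for $h<0$, $1$ for $h>0$, and is undefined at $h=0$. $\|\cdot\|$ is the Euclidean norm. *)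

theory Defs
  imports "HOL-Analysis.Analysis"
begin

definition relu :: "real \<Rightarrow> real"
  where "relu h = max h 0"

definition relu_vec :: "real ^ 'n \<Rightarrow> real ^ 'n"
  where "relu_vec v = (\<chi> i. relu (v $ i))"

(* Only the parameters with index at least 1 are used; W 0 and b 0 are irrelevant. *)
primrec dnn_state ::
  "(nat \<Rightarrow> real ^ 'n ^ 'n) \<Rightarrow> (nat \<Rightarrow> real ^ 'n) \<Rightarrow> real ^ 'n \<Rightarrow> nat \<Rightarrow> real ^ 'n"
where
  "dnn_state W b x0 0 = x0"
| "dnn_state W b x0 (Suc t) = relu_vec (W (Suc t) *v dnn_state W b x0 t + b (Suc t))"

(* The angle is meaningful only if x $ 1 is nonzero: HOL sets y / 0 = 0, so statements
   about the angle must carry this condition separately. *)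
definition state_angle :: "real ^ 2 \<Rightarrow> real"
  where "state_angle x = arctan (x $ 2 / x $ 1)"

end

theory Submission
  imports Defs
begin

text \<open>One layer suffices: it can multiply the second coordinate by an arbitrarily large gain while
  the bias moves the current state to the point (1, 1), where the ReLU is locally the identity and
  arctan has slope 1/2.\<close>

lemma relu_has_derivative_at_pos:
  assumes "h > 0"
  shows "(relu has_real_derivative 1) (at h)"
proof (rule has_field_derivative_transform_within_open[where f = "\<lambda>h. h" and S = "{0<..}"])
  show "\<And>x. x \<in> {0<..} \<Longrightarrow> x = relu x"
    by (simp add: relu_def)
qed (use assms in auto)

theorem theorem3:
  fixes x0 :: "real ^ 2" and C :: real
  assumes "\<forall>i. x0 $ i \<in> {-1..1}"
    and "C > 0"
  shows "\<exists>(W :: nat \<Rightarrow> real ^ 2 ^ 2) (b :: nat \<Rightarrow> real ^ 2) (T :: nat) (G :: real ^ 2).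
    T \<ge> 1 \<and>
    dnn_state W b x0 T $ 1 \<noteq> 0 \<and>
    GDERIV (\<lambda>x. state_angle (dnn_state W b x T)) x0 :> G \<and>
    norm G > C"
proof -
  \<comment> \<open>The zero first row pins the first coordinate to the bias entry 1 for every
    input, so the quotient in the angle is just the second coordinate. The gain \<open>4 * C\<close>
    is chosen to exceed \<open>C\<close> even after being halved by arctan.\<close>
  define W :: "nat \<Rightarrow> real ^ 2 ^ 2" where "W = (\<lambda>_. vector [vector [0, 0], vector [0, 4 * C]])"
  define b :: "nat \<Rightarrow> real ^ 2" where "b = (\<lambda>_. vector [1, 1 - 4 * C * x0 $ 2])"
  define g where "g = (\<lambda>s. arctan (relu (4 * C * s + (1 - 4 * C * x0 $ 2))))"
  have state1: "dnn_state W b x 1 $ 1 = 1" for x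
    by (simp add: W_def b_def relu_vec_def relu_def matrix_vector_mult_def sum_2)
  have state2: "dnn_state W b x 1 $ 2 = relu (4 * C * x $ 2 + (1 - 4 * C * x0 $ 2))" for x
    by (simp add: W_def b_def relu_vec_def matrix_vector_mult_def sum_2)
  \<comment> \<open>This identity holds for all \<open>x\<close>, not only near \<open>x0\<close>,
    so the gradient reduces to the ordinary derivative of \<open>g\<close> times the unit vector
    \<open>axis 2 1\<close>.\<close>
  have angle: "state_angle (dnn_state W b x 1) = g (x \<bullet> axis 2 1)" for x
    unfolding state_angle_def state1 state2 g_def by (simp add: inner_axis)
  \<comment> \<open>At \<open>x0 $ 2\<close> the bias cancels the gain term, so the argument of
    \<open>relu\<close> is exactly 1, away from the kink at 0. The product
    \<open>1 * (4 * C)\<close> is the form the chain rule produces.\<close>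
  have "((\<lambda>s. relu (4 * C * s + (1 - 4 * C * x0 $ 2))) has_real_derivative 1 * (4 * C)) (at (x0 $ 2))"
    by (rule DERIV_chain2[OF relu_has_derivative_at_pos]) (auto intro!: derivative_eq_intros)
  from DERIV_chain2[OF DERIV_arctan this]
  \<comment> \<open>The value is \<open>4 * C / (1 + 1^2)\<close>, since arctan is evaluated at
    \<open>relu 1 = 1\<close>.\<close>
  have "(g has_real_derivative 2 * C) (at (x0 $ 2))"
    by (simp add: g_def relu_def)
  moreover have "GDERIV (\<lambda>x. x \<bullet> axis 2 1) x0 :> axis 2 1"
    unfolding gderiv_def by (rule bounded_linear_imp_has_derivative[OF bounded_linear_inner_left])
  ultimately have "GDERIV (\<lambda>x. g (x \<bullet> axis 2 1)) x0 :> (2 * C) *\<^sub>R axis 2 1"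
    by (intro GDERIV_DERIV_compose) (simp_all add: inner_axis)
  then have "GDERIV (\<lambda>x. state_angle (dnn_state W b x 1)) x0 :> (2 * C) *\<^sub>R axis 2 1"
    by (simp only: angle)
  moreover have "norm ((2 * C) *\<^sub>R axis 2 1 :: real ^ 2) > C"
    using \<open>C > 0\<close> by simp
  moreover have "dnn_state W b x0 1 $ 1 \<noteq> 0"
    unfolding state1 by simp
  ultimately show ?thesis
    by blast
qed

end
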